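(* Assume the following two conditions. (a) If $(u_n)\subset \mathcal{N}\cap Y$ and $\Phi(u_n)\to c$, then $(u_n)$ has a subsequence converging weakly in $X$ to an element of $Y$. (b) For every $u\in Y$ the map $t\mapsto \Phi(tu)$, defined in $(0,\infty)$, has a unique critical point $t_u$, which is a global maximum point (in particular $\Phi(t_u u)>0$). Then $c>0$ and $c$ is achieved by a critical point of $\Phi$, i.e. there is $u_0\in\mathcal{N}\cap Y$ with $\Phi(u_0)=c$ and $\Phi'(u_0)=0$. If, in addition, $J(u)\neq 0$ for every $u\in X\setminus Y$ with $u\neq 0$, then $c$ is the ground state level of $\Phi$.
   Context: $X$ is a reflexive Banach space. $Y\subset X\setminus\{0\}$ is a nonempty open cone, i.e. a nonempty open set such that $tu\in Y$ for every $t>0$ and $u\in Y$. $\Phi\in C^1(X,\mathbb{R})$ with $\Phi(0)=0$, and $J:X\to\mathbb{R}$ is given by $J(u)=\Phi'(u)u$. Both $\Phi$ and $J$ are assumed weakly lower semicontinuous on $X$. $\mathcal{N}=\{u\in X\setminus\{0\}: \Phi'(u)u=0\}$ and $c:=\inf_{\mathcal{N}\cap Y}\Phi$. A ground state is a nontrivial critical point of $\Phi$ minimizing $\Phi$ over the set of all nontrivial critical points; a number is the ground state level of $\Phi$ if it is the value of $\Phi$ at a ground state. *)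

theory Defs
  imports "HOL-Analysis.Analysis"
begin

text \<open>Surjectivity of the canonical embedding of the space into its bidual.\<close>

definition reflexive_space :: "'a::real_normed_vector itself \<Rightarrow> bool" where
  "reflexive_space _ \<longleftrightarrow>
     (\<forall>F :: ('a \<Rightarrow>\<^sub>L real) \<Rightarrow>\<^sub>L real. \<exists>x::'a. \<forall>f. blinfun_apply F f = blinfun_apply f x)"

definition weakly_tendsto :: "(nat \<Rightarrow> 'a::real_normed_vector) \<Rightarrow> 'a \<Rightarrow> bool" where
  "weakly_tendsto x l \<longleftrightarrow>
     (\<forall>f :: 'a \<Rightarrow>\<^sub>L real. (\<lambda>n. blinfun_apply f (x n)) \<longlonglongrightarrow> blinfun_apply f l)"

text \<open>Weak lower semicontinuity is meant sequentially, as usual in the calculus of variations;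
  lower semicontinuity with respect to the weak topology implies it.\<close>

definition weakly_lsc :: "('a::real_normed_vector \<Rightarrow> real) \<Rightarrow> bool" where
  "weakly_lsc F \<longleftrightarrow>
     (\<forall>x l. weakly_tendsto x l \<longrightarrow> ereal (F l) \<le> liminf (\<lambda>n. ereal (F (x n))))"

text \<open>The library's \<open>cone\<close> and \<open>conic\<close> allow the factor \<open>0\<close>; here only positive factors
  are admitted and the origin is excluded.\<close>

definition nonempty_open_cone :: "'a::real_normed_vector set \<Rightarrow> bool" where
  "nonempty_open_cone Y \<longleftrightarrow>
     Y \<noteq> {} \<and> open Y \<and> 0 \<notin> Y \<and> (\<forall>t>0. \<forall>u\<in>Y. t *\<^sub>R u \<in> Y)"

text \<open>Continuity of the derivative is in the operator norm of the dual space.\<close>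

definition C1_functional :: "('a::real_normed_vector \<Rightarrow> real) \<Rightarrow> bool" where
  "C1_functional \<Phi> \<longleftrightarrow>
     (\<exists>D :: 'a \<Rightarrow> ('a \<Rightarrow>\<^sub>L real).
        (\<forall>u. (\<Phi> has_derivative blinfun_apply (D u)) (at u)) \<and> continuous_on UNIV D)"

definition critical_point :: "('a::real_normed_vector \<Rightarrow> real) \<Rightarrow> 'a \<Rightarrow> bool" where
  "critical_point \<Phi> u \<longleftrightarrow> (\<Phi> has_derivative (\<lambda>_. 0)) (at u)"

text \<open>The functional \<open>J\<close>, that is, \<open>J(u) = \<Phi>'(u)u\<close>; meaningful for differentiable \<open>\<Phi>\<close> only.\<close>

definition nehari_functional :: "('a::real_normed_vector \<Rightarrow> real) \<Rightarrow> 'a \<Rightarrow> real" where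
  "nehari_functional \<Phi> u = frechet_derivative \<Phi> (at u) u"

definition nehari_set :: "('a::real_normed_vector \<Rightarrow> real) \<Rightarrow> 'a set" where
  "nehari_set \<Phi> = {u. u \<noteq> 0 \<and> nehari_functional \<Phi> u = 0}"

definition ground_state :: "('a::real_normed_vector \<Rightarrow> real) \<Rightarrow> 'a \<Rightarrow> bool" where
  "ground_state \<Phi> u \<longleftrightarrow>
     u \<noteq> 0 \<and> critical_point \<Phi> u \<and> (\<forall>v. v \<noteq> 0 \<and> critical_point \<Phi> v \<longrightarrow> \<Phi> u \<le> \<Phi> v)"

definition ground_state_level :: "('a::real_normed_vector \<Rightarrow> real) \<Rightarrow> real \<Rightarrow> bool" where
  "ground_state_level \<Phi> l \<longleftrightarrow> (\<exists>u. ground_state \<Phi> u \<and> \<Phi> u = l)"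

text \<open>Positivity of the maximum value is not required: it follows when \<open>\<Phi>\<close> is differentiable
  and \<open>\<Phi>(0) = 0\<close>, by Rolle's theorem.\<close>

definition fibering_unique_max :: "('a::real_normed_vector \<Rightarrow> real) \<Rightarrow> 'a \<Rightarrow> bool" where
  "fibering_unique_max \<Phi> u \<longleftrightarrow>
     (\<exists>t>0. ((\<lambda>s. \<Phi> (s *\<^sub>R u)) has_real_derivative 0) (at t) \<and>
            (\<forall>r>0. ((\<lambda>s. \<Phi> (s *\<^sub>R u)) has_real_derivative 0) (at r) \<longrightarrow> r = t) \<and>
            (\<forall>r>0. \<Phi> (r *\<^sub>R u) \<le> \<Phi> (t *\<^sub>R u)))"

end

theory Submission imports Defs begin

text \<open>
  Write \<open>N\<close> for the Nehari set. A point \<open>u\<close> of \<open>Y\<close> lies in \<open>N\<close> exactly when the critical point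
  of the fibering map \<open>t \<mapsto> \<Phi>(t u)\<close> is \<open>1\<close>. Hence every ray in \<open>Y\<close> meets \<open>N\<close> exactly once, and
  there \<open>\<Phi>\<close> attains its maximum along the ray. This maximum is positive: the values
  near \<open>t = 0\<close> force it to be nonnegative, and if it were \<open>0 = \<Phi>(0)\<close>, then Rolle's theorem would give
  a second critical point on the ray.

  \<^bold>\<open>The infimum is attained.\<close> Let \<open>u\<^sub>n \<in> N \<inter> Y\<close> be a minimizing sequence with weak limit \<open>l \<in> Y\<close>,
  and choose \<open>t > 0\<close> with \<open>t l \<in> N\<close>. Then \<open>t u\<^sub>n\<close> converges weakly to \<open>t l\<close>, and \<open>\<Phi>(t u\<^sub>n) \<le> \<Phi>(u\<^sub>n)\<close>
  because \<open>u\<^sub>n\<close> maximizes \<open>\<Phi>\<close> on its ray. Weak lower semicontinuity gives \<open>\<Phi>(t l) \<le> c\<close>, so \<open>t l\<close> is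
  a minimizer, and \<open>c = \<Phi>(t l) > 0\<close>.

  \<^bold>\<open>A minimizer is critical.\<close> The set \<open>N\<close> need not be a manifold, so a Lagrange multiplier
  is replaced by a comparison of rays. If \<open>\<Phi>'(u\<^sub>0) v < 0\<close>, move from \<open>u\<^sub>0\<close> to \<open>u\<^sub>0 + s v\<close> with \<open>s\<close>
  small. The ray through this point meets \<open>N\<close> at some \<open>t (u\<^sub>0 + s v)\<close> with \<open>t\<close> close to \<open>1\<close>
  (lemma \<open>nearby_rays_meet_nehari_set\<close>), and therefore
  \<open>\<Phi>(t (u\<^sub>0 + s v)) < \<Phi>(t u\<^sub>0) \<le> \<Phi>(u\<^sub>0)\<close>, which contradicts minimality.

  \<^bold>\<open>The ground state level.\<close> Every nontrivial critical point is a zero of \<open>J\<close>. If all nonzero zeros of \<open>J\<close> lie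
  in \<open>Y\<close>, then every nontrivial critical point competes in the infimum defining \<open>c\<close>.
\<close>

section \<open>Fibering maps and the Nehari set\<close>

locale fibered_functional =
  fixes \<Phi> :: "'a::real_normed_vector \<Rightarrow> real"
    and D :: "'a \<Rightarrow> 'a \<Rightarrow>\<^sub>L real"
    and Y :: "'a set"
  assumes has_derivative_D: "(\<Phi> has_derivative blinfun_apply (D u)) (at u)"
    and continuous_D: "continuous_on UNIV D"
    and at_zero: "\<Phi> 0 = 0"
    and cone: "nonempty_open_cone Y"
    and fibering: "u \<in> Y \<Longrightarrow> fibering_unique_max \<Phi> u"
begin

lemma scale_in_cone: "t > 0 \<Longrightarrow> u \<in> Y \<Longrightarrow> t *\<^sub>R u \<in> Y"
  using cone by (auto simp: nonempty_open_cone_def)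

lemma nonzero_in_cone: "u \<in> Y \<Longrightarrow> u \<noteq> 0"
  using cone by (auto simp: nonempty_open_cone_def)

lemma open_cone: "open Y"
  using cone by (auto simp: nonempty_open_cone_def)

lemma continuous_functional: "continuous_on S \<Phi>"
  using has_derivative_D has_derivative_continuous continuous_at_imp_continuous_on by blast

lemma has_real_derivative_line:
  "((\<lambda>s. \<Phi> (p + s *\<^sub>R v)) has_real_derivative D (p + s *\<^sub>R v) v) (at s)"
proof -
  have "((\<lambda>s. p + s *\<^sub>R v) has_derivative (\<lambda>h. h *\<^sub>R v)) (at s)"
    by (auto intro!: derivative_eq_intros)
  from has_derivative_compose[OF this has_derivative_D]
  show ?thesis
    by (simp add: has_field_derivative_def blinfun.scaleR_right mult.commute[of _ "D _ v"])
qed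

lemma has_real_derivative_ray:
  "((\<lambda>s. \<Phi> (s *\<^sub>R u)) has_real_derivative D (s *\<^sub>R u) u) (at s)"
  using has_real_derivative_line[of 0 u s] by simp

lemma continuous_ray: "continuous_on S (\<lambda>s. \<Phi> (s *\<^sub>R u))"
  by (intro continuous_on_compose2[OF continuous_functional[of UNIV]] continuous_intros) auto

lemma nehari_functional_eq: "nehari_functional \<Phi> u = D u u"
  unfolding nehari_functional_def
  using frechet_derivative_at[OF has_derivative_D[of u]] by simp

lemma critical_point_imp_derivative_zero: "critical_point \<Phi> u \<Longrightarrow> D u v = 0"
  unfolding critical_point_def using has_derivative_unique[OF has_derivative_D] by metis

lemma nehari_set_iff_ray_critical:
  assumes "u \<in> Y" "t > 0"
  shows "t *\<^sub>R u \<in> nehari_set \<Phi> \<longleftrightarrow> ((\<lambda>s. \<Phi> (s *\<^sub>R u)) has_real_derivative 0) (at t)"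
proof -
  have "t *\<^sub>R u \<in> nehari_set \<Phi> \<longleftrightarrow> D (t *\<^sub>R u) u = 0"
    using assms nonzero_in_cone[of u]
    by (auto simp: nehari_set_def nehari_functional_eq blinfun.scaleR_right)
  then show ?thesis
    using has_real_derivative_ray[of u t] DERIV_unique by metis
qed

lemma nehari_maximizes_ray:
  assumes "u \<in> nehari_set \<Phi> \<inter> Y" "r > 0"
  shows "\<Phi> (r *\<^sub>R u) \<le> \<Phi> u"
proof -
  obtain t where "\<And>r. r > 0 \<Longrightarrow> ((\<lambda>s. \<Phi> (s *\<^sub>R u)) has_real_derivative 0) (at r) \<Longrightarrow> r = t"
    and "\<And>r. r > 0 \<Longrightarrow> \<Phi> (r *\<^sub>R u) \<le> \<Phi> (t *\<^sub>R u)"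
    using fibering assms(1) unfolding fibering_unique_max_def by blast
  moreover have "((\<lambda>s. \<Phi> (s *\<^sub>R u)) has_real_derivative 0) (at 1)"
    using nehari_set_iff_ray_critical[of u 1] assms(1) by simp
  ultimately show ?thesis
    using assms(2) by (metis scaleR_one zero_less_one)
qed

text \<open>A second point of the ray with the same value would be a second maximum of the fibering map,
  hence a second critical point.\<close>

lemma nehari_maximizes_ray_strictly:
  assumes u: "u \<in> nehari_set \<Phi> \<inter> Y" and r: "r > 0" "r \<noteq> 1"
  shows "\<Phi> (r *\<^sub>R u) < \<Phi> u"
proof (rule ccontr)
  assume "\<not> \<Phi> (r *\<^sub>R u) < \<Phi> u"
  then have max: "\<Phi> (s *\<^sub>R u) \<le> \<Phi> (r *\<^sub>R u)" if "s > 0" for s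
    using nehari_maximizes_ray[OF u that] by linarith
  have "D (r *\<^sub>R u) u = 0"
    by (rule DERIV_local_max[OF has_real_derivative_ray \<open>r > 0\<close>]) (auto intro!: max)
  then have "((\<lambda>s. \<Phi> (s *\<^sub>R u)) has_real_derivative 0) (at r)"
    using has_real_derivative_ray[of u r] by simp
  moreover have "((\<lambda>s. \<Phi> (s *\<^sub>R u)) has_real_derivative 0) (at 1)"
    using nehari_set_iff_ray_critical[of u 1] u by simp
  ultimately show False
    using fibering[of u] u r unfolding fibering_unique_max_def by (metis IntD2 zero_less_one)
qed

lemma ray_meets_nehari_set:
  assumes "u \<in> Y"
  obtains t where "t > 0" "t *\<^sub>R u \<in> nehari_set \<Phi> \<inter> Y"
proof -
  obtain t where "t > 0" "((\<lambda>s. \<Phi> (s *\<^sub>R u)) has_real_derivative 0) (at t)"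
    using fibering[OF assms] unfolding fibering_unique_max_def by blast
  then show thesis
    using that[of t] nehari_set_iff_ray_critical[OF assms] scale_in_cone[OF _ assms] by simp
qed

text \<open>Letting \<open>s\<close> tend to \<open>0\<close> in \<open>\<Phi>(s u) \<le> \<Phi>(u)\<close> gives \<open>\<Phi>(u) \<ge> 0\<close>. Equality is excluded by Rolle's
  theorem on \<open>[0, 1]\<close>, which would produce a second critical point of the fibering map.\<close>

lemma nehari_positive:
  assumes u: "u \<in> nehari_set \<Phi> \<inter> Y"
  shows "\<Phi> u > 0"
proof -
  have cont: "continuous_on {0..1} (\<lambda>s. \<Phi> (s *\<^sub>R u))"
    by (rule continuous_ray)
  have "((\<lambda>s. \<Phi> (s *\<^sub>R u)) \<longlongrightarrow> \<Phi> (0 *\<^sub>R u)) (at_right 0)"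
    using has_real_derivative_ray[of u 0, THEN DERIV_isCont]
    by (simp add: isCont_def filterlim_at_split)
  moreover have "\<forall>\<^sub>F s in at_right 0. \<Phi> (s *\<^sub>R u) \<le> \<Phi> u"
    using nehari_maximizes_ray[OF u] by (simp add: eventually_at_filter)
  ultimately have "\<Phi> u \<ge> 0"
    using at_zero by (auto intro: tendsto_upperbound)
  moreover have "\<Phi> u \<noteq> 0"
  proof
    assume "\<Phi> u = 0"
    then have "\<exists>z. 0 < z \<and> z < 1 \<and> ((\<lambda>s. \<Phi> (s *\<^sub>R u)) has_real_derivative 0) (at z)"
      using at_zero has_real_derivative_ray[of u]
      by (intro Rolle cont) (auto simp: real_differentiable_def)
    then obtain z where z: "0 < z" "z < 1" "((\<lambda>s. \<Phi> (s *\<^sub>R u)) has_real_derivative 0) (at z)"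
      by blast
    moreover have "((\<lambda>s. \<Phi> (s *\<^sub>R u)) has_real_derivative 0) (at 1)"
      using nehari_set_iff_ray_critical[of u 1] u by simp
    ultimately show False
      using fibering[of u] u unfolding fibering_unique_max_def
      by (metis IntD2 less_irrefl zero_less_one)
  qed
  ultimately show ?thesis by simp
qed

section \<open>Minimizers are critical points\<close>

text \<open>The strict inequalities \<open>\<Phi>((1 \<plusminus> \<epsilon>) u) < \<Phi>(u)\<close> persist when \<open>u\<close> is replaced by a nearby point
  \<open>w\<close>. The maximum of the fibering map of \<open>w\<close> over \<open>[1 - \<epsilon>, 1 + \<epsilon>]\<close> is then interior, hence
  critical. This expresses that the critical point of the
  fibering map depends continuously on the ray.\<close>

lemma nearby_rays_meet_nehari_set:
  assumes u: "u \<in> nehari_set \<Phi> \<inter> Y" and \<epsilon>: "0 < \<epsilon>" "\<epsilon> < 1"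
  shows "\<forall>\<^sub>F w in nhds u. \<exists>t. \<bar>t - 1\<bar> < \<epsilon> \<and> t *\<^sub>R w \<in> nehari_set \<Phi> \<inter> Y"
proof -
  have persists: "\<forall>\<^sub>F w in nhds u. \<Phi> (r *\<^sub>R w) < \<Phi> w" if "r > 0" "r \<noteq> 1" for r
  proof -
    have "open {w. \<Phi> (r *\<^sub>R w) < \<Phi> w}"
      by (intro open_Collect_less continuous_on_compose2[OF continuous_functional[of UNIV]]
          continuous_intros continuous_functional) auto
    then show ?thesis
      using eventually_nhds_in_open nehari_maximizes_ray_strictly[OF u that] by force
  qed
  have "\<forall>\<^sub>F w in nhds u. w \<in> Y"
    using eventually_nhds_in_open open_cone u by blast
  moreover have "\<forall>\<^sub>F w in nhds u. \<Phi> ((1 - \<epsilon>) *\<^sub>R w) < \<Phi> w"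
    using persists \<epsilon> by simp
  moreover have "\<forall>\<^sub>F w in nhds u. \<Phi> ((1 + \<epsilon>) *\<^sub>R w) < \<Phi> w"
    using persists \<epsilon> by simp
  ultimately show ?thesis
  proof eventually_elim
    case (elim w)
    have "continuous_on {1 - \<epsilon>..1 + \<epsilon>} (\<lambda>s. \<Phi> (s *\<^sub>R w))"
      by (rule continuous_ray)
    then obtain t where t: "t \<in> {1 - \<epsilon>..1 + \<epsilon>}"
      and max: "\<And>s. s \<in> {1 - \<epsilon>..1 + \<epsilon>} \<Longrightarrow> \<Phi> (s *\<^sub>R w) \<le> \<Phi> (t *\<^sub>R w)"
      using continuous_attains_sup[of "{1 - \<epsilon>..1 + \<epsilon>}" "\<lambda>s. \<Phi> (s *\<^sub>R w)"] \<epsilon> by auto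
    have "\<Phi> w \<le> \<Phi> (t *\<^sub>R w)"
      using max[of 1] \<epsilon> by simp
    then have "t \<noteq> 1 - \<epsilon>" "t \<noteq> 1 + \<epsilon>"
      using elim by auto
    then have near: "\<bar>t - 1\<bar> < \<epsilon>"
      using t by auto
    have "D (t *\<^sub>R w) w = 0"
    proof (rule DERIV_local_max[OF has_real_derivative_ray])
      show "0 < \<epsilon> - \<bar>t - 1\<bar>"
        using near by simp
    qed (auto intro!: max)
    then have "((\<lambda>s. \<Phi> (s *\<^sub>R w)) has_real_derivative 0) (at t)"
      using has_real_derivative_ray[of w t] by simp
    then have "t *\<^sub>R w \<in> nehari_set \<Phi> \<inter> Y"
      using near \<epsilon> elim nehari_set_iff_ray_critical[of w t] scale_in_cone[of t w] by auto
    with near show ?case by blast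
  qed
qed

text \<open>The displacement along \<open>v\<close> has to be compared at the rescaled points \<open>t u\<close> and \<open>t (u + s v)\<close>,
  so the derivative in direction \<open>v\<close> must stay negative jointly for \<open>t\<close> near \<open>1\<close> and \<open>s\<close> near \<open>0\<close>.
  This is where continuity of the derivative enters.\<close>

lemma no_descent_direction_at_minimizer:
  assumes u: "u \<in> nehari_set \<Phi> \<inter> Y"
    and min: "\<And>w. w \<in> nehari_set \<Phi> \<inter> Y \<Longrightarrow> \<Phi> u \<le> \<Phi> w"
  shows "D u v \<ge> 0"
proof (rule ccontr)
  assume "\<not> D u v \<ge> 0"
  then have neg: "D u v < 0" by simp
  have "open {z :: real \<times> real. D (fst z *\<^sub>R (u + snd z *\<^sub>R v)) v < 0}"
    by (intro open_Collect_less continuous_intros continuous_on_compose2[OF continuous_D]) auto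
  moreover have "(1, 0) \<in> {z :: real \<times> real. D (fst z *\<^sub>R (u + snd z *\<^sub>R v)) v < 0}"
    using neg by simp
  ultimately obtain d where d: "d > 0"
    and descent: "\<And>z. dist z (1, 0) < d \<Longrightarrow> D (fst z *\<^sub>R (u + snd z *\<^sub>R v)) v < 0"
    unfolding open_dist by blast
  \<comment> \<open>With \<open>\<bar>t - 1\<bar>\<close> and \<open>s\<close> both below \<open>d / 2\<close>, the pair \<open>(t, s)\<close> stays within \<open>d\<close> of \<open>(1, 0)\<close>.\<close>
  define \<epsilon> where "\<epsilon> = min (1 / 2) (d / 2)"
  have \<epsilon>: "0 < \<epsilon>" "\<epsilon> < 1" "\<epsilon> \<le> d / 2"
    using d by (auto simp: \<epsilon>_def)
  have "((\<lambda>s. u + s *\<^sub>R v) \<longlongrightarrow> u) (at_right 0)"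
    by (auto intro!: tendsto_eq_intros)
  from eventually_compose_filterlim[OF nearby_rays_meet_nehari_set[OF u \<epsilon>(1,2)] this]
  have "\<forall>\<^sub>F s in at_right 0. \<exists>t. \<bar>t - 1\<bar> < \<epsilon> \<and> t *\<^sub>R (u + s *\<^sub>R v) \<in> nehari_set \<Phi> \<inter> Y" .
  moreover have "\<forall>\<^sub>F s in at_right 0. s \<in> {0<..<d / 2}"
    using eventually_at_right_real[of 0 "d / 2"] d by simp
  ultimately have "\<forall>\<^sub>F s in at_right 0. s \<in> {0<..<d / 2} \<and>
      (\<exists>t. \<bar>t - 1\<bar> < \<epsilon> \<and> t *\<^sub>R (u + s *\<^sub>R v) \<in> nehari_set \<Phi> \<inter> Y)"
    by eventually_elim simp
  from eventually_happens'[OF trivial_limit_at_right_real this]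
  obtain s t where s: "0 < s" "s < d / 2" and t: "\<bar>t - 1\<bar> < \<epsilon>"
    and w: "t *\<^sub>R (u + s *\<^sub>R v) \<in> nehari_set \<Phi> \<inter> Y"
    by auto
  have "t > 0"
    using t \<epsilon> by linarith
  have "\<Phi> (t *\<^sub>R u + s *\<^sub>R t *\<^sub>R v) < \<Phi> (t *\<^sub>R u + 0 *\<^sub>R t *\<^sub>R v)"
  proof (rule DERIV_neg_imp_decreasing[OF \<open>0 < s\<close>])
    fix x assume x: "0 \<le> x" "x \<le> s"
    have "dist (t, x) (1, 0) \<le> \<bar>t - 1\<bar> + \<bar>x\<bar>"
      using sqrt_sum_squares_le_sum_abs[of "t - 1" x] by (simp add: dist_prod_def dist_real_def)
    also have "\<dots> < d"
      using x s t \<epsilon> by linarith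
    finally have "D (t *\<^sub>R (u + x *\<^sub>R v)) v < 0"
      using descent[of "(t, x)"] by simp
    then have "D (t *\<^sub>R u + x *\<^sub>R t *\<^sub>R v) (t *\<^sub>R v) < 0"
      using \<open>t > 0\<close> by (simp add: blinfun.scaleR_right scaleR_add_right mult.commute mult_pos_neg)
    then show "\<exists>y. ((\<lambda>x. \<Phi> (t *\<^sub>R u + x *\<^sub>R t *\<^sub>R v)) has_real_derivative y) (at x) \<and> y < 0"
      using has_real_derivative_line by blast
  qed
  then have "\<Phi> (t *\<^sub>R (u + s *\<^sub>R v)) < \<Phi> (t *\<^sub>R u)"
    by (simp add: scaleR_add_right mult.commute)
  also have "\<dots> \<le> \<Phi> u"
    using nehari_maximizes_ray[OF u \<open>t > 0\<close>] .
  also have "\<dots> \<le> \<Phi> (t *\<^sub>R (u + s *\<^sub>R v))"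
    using min[OF w] .
  finally show False by simp
qed

lemma minimizer_is_critical:
  assumes "u \<in> nehari_set \<Phi> \<inter> Y"
    and "\<And>w. w \<in> nehari_set \<Phi> \<inter> Y \<Longrightarrow> \<Phi> u \<le> \<Phi> w"
  shows "critical_point \<Phi> u"
proof -
  have "D u v = 0" for v
    using no_descent_direction_at_minimizer[OF assms, of v]
      no_descent_direction_at_minimizer[OF assms, of "- v"]
    by (simp add: blinfun.minus_right)
  then have "blinfun_apply (D u) = (\<lambda>_. 0)"
    by auto
  then show ?thesis
    using has_derivative_D[of u] by (simp add: critical_point_def)
qed

section \<open>Minimizing sequences\<close>

text \<open>The members of the sequence are rescaled by the factor that takes the weak limit into
  the Nehari set; this can only lower their values, and it commutes with the weak limit.\<close>

lemma weak_limit_rescales_below: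
  assumes lsc: "weakly_lsc \<Phi>"
    and x: "\<And>n. x n \<in> nehari_set \<Phi> \<inter> Y" "(\<lambda>n. \<Phi> (x n)) \<longlonglongrightarrow> c"
    and l: "weakly_tendsto x l" "l \<in> Y"
  obtains u where "u \<in> nehari_set \<Phi> \<inter> Y" "\<Phi> u \<le> c"
proof -
  obtain t where t: "t > 0" "t *\<^sub>R l \<in> nehari_set \<Phi> \<inter> Y"
    using ray_meets_nehari_set[OF l(2)] .
  have "weakly_tendsto (\<lambda>n. t *\<^sub>R x n) (t *\<^sub>R l)"
    using l(1) by (simp add: weakly_tendsto_def blinfun.scaleR_right tendsto_mult_left)
  then have "ereal (\<Phi> (t *\<^sub>R l)) \<le> liminf (\<lambda>n. ereal (\<Phi> (t *\<^sub>R x n)))"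
    using lsc by (simp add: weakly_lsc_def)
  also have "\<dots> \<le> liminf (\<lambda>n. ereal (\<Phi> (x n)))"
    using nehari_maximizes_ray[OF x(1) t(1)] by (intro Liminf_mono always_eventually) simp
  also have "\<dots> = ereal c"
    using x(2) by (intro lim_imp_Liminf) simp_all
  finally show thesis
    using that t(2) by simp
qed

end

section \<open>The ground state level\<close>

theorem theorem2p1:
  fixes \<Phi> :: "'a::banach \<Rightarrow> real" and Y :: "'a set" and c :: real
  assumes "reflexive_space TYPE('a)"
    and "nonempty_open_cone Y"
    and "C1_functional \<Phi>"
    and "\<Phi> 0 = 0"
    and "weakly_lsc \<Phi>"
    and "weakly_lsc (nehari_functional \<Phi>)"
    and "c = (INF u \<in> nehari_set \<Phi> \<inter> Y. \<Phi> u)"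
    and "\<forall>u :: nat \<Rightarrow> 'a. (\<forall>n. u n \<in> nehari_set \<Phi> \<inter> Y) \<and> (\<lambda>n. \<Phi> (u n)) \<longlonglongrightarrow> c \<longrightarrow>
           (\<exists>r l. strict_mono (r :: nat \<Rightarrow> nat) \<and> l \<in> Y \<and> weakly_tendsto (u \<circ> r) l)"
    and "\<forall>u\<in>Y. fibering_unique_max \<Phi> u"
  shows "c > 0
    \<and> (\<exists>u\<^sub>0 \<in> nehari_set \<Phi> \<inter> Y. \<Phi> u\<^sub>0 = c \<and> critical_point \<Phi> u\<^sub>0)
    \<and> ((\<forall>u. u \<notin> Y \<and> u \<noteq> 0 \<longrightarrow> nehari_functional \<Phi> u \<noteq> 0) \<longrightarrow> ground_state_level \<Phi> c)"
proof -
  obtain D :: "'a \<Rightarrow> 'a \<Rightarrow>\<^sub>L real"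
    where D: "\<And>u. (\<Phi> has_derivative blinfun_apply (D u)) (at u)" "continuous_on UNIV D"
    using assms(3) unfolding C1_functional_def by blast
  interpret fibered_functional \<Phi> D Y
    using D assms(2,4,9) by unfold_locales auto
  let ?M = "nehari_set \<Phi> \<inter> Y"
  have bdd: "bdd_below (\<Phi> ` ?M)"
    using nehari_positive by (intro bdd_belowI2[of _ 0]) (simp add: less_imp_le)
  have lower: "c \<le> \<Phi> w" if "w \<in> ?M" for w
    unfolding assms(7) using cINF_lower[OF bdd that] .
  have "?M \<noteq> {}"
    using cone ray_meets_nehari_set unfolding nonempty_open_cone_def by blast
  then have "\<exists>w\<in>?M. \<Phi> w < c + 1 / real (Suc n)" for n
    using cINF_less_iff[OF _ bdd, of "c + 1 / real (Suc n)"] assms(7) by simp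
  then obtain x where x: "\<And>n. x n \<in> ?M" "\<And>n. \<Phi> (x n) < c + 1 / real (Suc n)"
    by metis
  have upper: "(\<lambda>n. c + 1 / real (Suc n)) \<longlonglongrightarrow> c"
    using tendsto_add[OF tendsto_const[of c] LIMSEQ_Suc[OF lim_1_over_n]] by simp
  have minimizing: "(\<lambda>n. \<Phi> (x n)) \<longlonglongrightarrow> c"
    by (rule tendsto_sandwich[OF _ _ tendsto_const upper])
      (use lower x in \<open>auto intro!: always_eventually less_imp_le simp del: of_nat_Suc\<close>)
  then obtain r l where r: "strict_mono (r :: nat \<Rightarrow> nat)" "l \<in> Y" "weakly_tendsto (x \<circ> r) l"
    using assms(8) x(1) by blast
  have "(\<lambda>n. \<Phi> ((x \<circ> r) n)) \<longlonglongrightarrow> c"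
    using LIMSEQ_subseq_LIMSEQ[OF minimizing r(1)] by (simp add: o_def)
  then obtain u where u: "u \<in> ?M" "\<Phi> u \<le> c"
    using weak_limit_rescales_below[OF assms(5) _ _ r(3,2)] x(1) by (metis comp_apply)
  have val: "\<Phi> u = c"
    using u lower by (simp add: order_antisym)
  have crit: "critical_point \<Phi> u"
    using minimizer_is_critical[OF u(1)] lower val by simp
  have "ground_state \<Phi> u"
    if off: "\<forall>u. u \<notin> Y \<and> u \<noteq> 0 \<longrightarrow> nehari_functional \<Phi> u \<noteq> 0"
  proof -
    have "c \<le> \<Phi> v" if "v \<noteq> 0" "critical_point \<Phi> v" for v
    proof (rule lower)
      have "nehari_functional \<Phi> v = 0"
        using critical_point_imp_derivative_zero[OF that(2)] by (simp add: nehari_functional_eq)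
      then show "v \<in> ?M"
        using off that(1) by (auto simp: nehari_set_def)
    qed
    then show ?thesis
      using u(1) crit val nonzero_in_cone by (auto simp: ground_state_def)
  qed
  then show ?thesis
    using nehari_positive[OF u(1)] u(1) val crit by (auto simp: ground_state_level_def)
qed

end
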